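(* Let $m\le n$, let $Q=[q_{ij}]\in\mathcal{O}(m,n)$ have sign pattern $S$, and let $P\in\mathcal{O}(n)$ satisfy $QP^T=\left[\begin{array}{c|c}I & O\end{array}\right]$. (i) If the rows of $\Psi_P(Q)$ are linearly independent, then every super pattern of $S$ allows orthogonality. (ii) If the columns of $\Omega(Q)$ are linearly independent, then every super pattern of $S$ allows orthogonality.
   Context: All matrices are real. $\mathcal{O}(m,n)=\{Q\in\mathbb{R}^{m\times n}:QQ^T=I\}$ and $\mathcal{O}(n)=\mathcal{O}(n,n)$. $\operatorname{vec}(A)$ stacks the columns of $A\in\mathbb{R}^{m\times n}$, so its entries are indexed by the pairs $(i,j)$. $E_{ij}$ denotes a matrix unit. Sign pattern: a $(0,1,-1)$-matrix; $\operatorname{sgn}(A)$ is the entrywise sign; $S$ allows orthogonality if some matrix in $\mathcal{O}(m,n)$ has sign pattern $S$. For sign patterns $S=[s_{ij}]$, $R=[r_{ij}]$, $S_{\vec R}$ has $(i,j)$-entry $s_{ij}$ if $s_{ij}\neq0$ and $r_{ij}$ otherwise; a super pattern of $S$ is any $S_{\vec R}$. Tangent space matrix: with $K_{ij}=E_{ij}-E_{ji}\in\mathbb{R}^{m\times n}$, set $B_{ij}=K_{ij}P$ for $1\le i<j\le m$ and $B_{ij}=E_{ij}P$ ($E_{ij}\in\mathbb{R}^{m\times n}$) for $1\le i\le m<j\le n$; $\mathrm{TS}_P(Q)$ is the matrix whose columns are the $\operatorname{vec}(B_{ij})$, rows indexed by pairs $(i,j)$. The tangent verification matrix $\Psi_P(Q)$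 is the submatrix of $\mathrm{TS}_P(Q)$ formed by the rows indexed by $\{(i,j):q_{ij}=0\}$. Normal space matrix: with $E_{ij}$ the $m\times m$ matrix units, set $C_{ij}=(E_{ij}+E_{ji})Q$ for $i<j$ and $C_{ii}=E_{ii}Q$; $\mathrm{NS}(Q)$ has columns $\operatorname{vec}(C_{ij})$, $1\le i\le j\le m$. The normal verification matrix $\Omega(Q)$ is the submatrix of $\mathrm{NS}(Q)$ formed by the rows indexed by $\{(i,j):q_{ij}\neq0\}$. *)

theory Defs
  imports "Jordan_Normal_Form.VS_Connect" "Jordan_Normal_Form.DL_Submatrix"
begin

text \<open>Row and column indices start at 0, so the ranges \<open>1 \<le> i < j \<le> m\<close> and
  \<open>1 \<le> i \<le> m < j \<le> n\<close> become \<open>i < j < m\<close> and \<open>i < m \<le> j < n\<close>.\<close>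

definition orth_mats :: "nat \<Rightarrow> nat \<Rightarrow> real mat set" where
  "orth_mats m n = {Q \<in> carrier_mat m n. Q * transpose_mat Q = 1\<^sub>m m}"

definition sign_pattern :: "real mat \<Rightarrow> bool" where
  "sign_pattern S \<longleftrightarrow> elements_mat S \<subseteq> {0, 1, -1}"

definition sgn_mat :: "real mat \<Rightarrow> real mat" where
  "sgn_mat A = map_mat sgn A"

definition allows_orthogonality :: "real mat \<Rightarrow> bool" where
  "allows_orthogonality S \<longleftrightarrow> (\<exists>Q \<in> orth_mats (dim_row S) (dim_col S). sgn_mat Q = S)"

definition fill_zeros :: "real mat \<Rightarrow> real mat \<Rightarrow> real mat" where
  "fill_zeros S R = mat (dim_row S) (dim_col S)
     (\<lambda>(i, j). if S $$ (i, j) \<noteq> 0 then S $$ (i, j) else R $$ (i, j))"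

definition super_pattern :: "real mat \<Rightarrow> real mat \<Rightarrow> bool" where
  "super_pattern T S \<longleftrightarrow>
     (\<exists>R \<in> carrier_mat (dim_row S) (dim_col S). sign_pattern R \<and> T = fill_zeros S R)"

definition unit_mat :: "nat \<Rightarrow> nat \<Rightarrow> nat \<Rightarrow> nat \<Rightarrow> real mat" where
  "unit_mat m n i j = mat m n (\<lambda>(k, l). if k = i \<and> l = j then 1 else 0)"

text \<open>Column stacking: for a matrix with \<open>m\<close> rows, entry \<open>(i, j)\<close> is at position \<open>j * m + i\<close>.\<close>

definition vec_of_mat :: "real mat \<Rightarrow> real vec" where
  "vec_of_mat A = vec (dim_row A * dim_col A)
     (\<lambda>k. A $$ (k mod dim_row A, k div dim_row A))"

text \<open>Positions in the column stacking of the entries of \<open>A\<close> that satisfy \<open>p\<close>.\<close>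

definition vec_positions :: "(real \<Rightarrow> bool) \<Rightarrow> real mat \<Rightarrow> nat set" where
  "vec_positions p A = {j * dim_row A + i | i j. i < dim_row A \<and> j < dim_col A \<and> p (A $$ (i, j))}"

text \<open>The order of the columns below is an arbitrary choice; \<open>Q\<close> enters
  the tangent space matrix only through its dimensions.\<close>

definition tangent_space_mat :: "real mat \<Rightarrow> real mat \<Rightarrow> real mat" where
  "tangent_space_mat P Q = (let m = dim_row Q; n = dim_col Q in
     mat_of_cols (m * n)
       ([vec_of_mat ((unit_mat m n i j - unit_mat m n j i) * P). i \<leftarrow> [0..<m], j \<leftarrow> [Suc i..<m]] @
        [vec_of_mat (unit_mat m n i j * P). i \<leftarrow> [0..<m], j \<leftarrow> [m..<n]]))"

definition tangent_verification_mat :: "real mat \<Rightarrow> real mat \<Rightarrow> real mat" where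
  "tangent_verification_mat P Q =
     submatrix (tangent_space_mat P Q) (vec_positions (\<lambda>x. x = 0) Q) UNIV"

definition normal_space_mat :: "real mat \<Rightarrow> real mat" where
  "normal_space_mat Q = (let m = dim_row Q; n = dim_col Q in
     mat_of_cols (m * n)
       [vec_of_mat ((if i = j then unit_mat m m i i else unit_mat m m i j + unit_mat m m j i) * Q).
          i \<leftarrow> [0..<m], j \<leftarrow> [i..<m]])"

definition normal_verification_mat :: "real mat \<Rightarrow> real mat" where
  "normal_verification_mat Q =
     submatrix (normal_space_mat Q) (vec_positions (\<lambda>x. x \<noteq> 0) Q) UNIV"

text \<open>Linear independence of a family of vectors: repeated members make it dependent,
  hence the distinctness condition on top of the library notion for sets.\<close>

definition lin_indep_list :: "nat \<Rightarrow> real vec list \<Rightarrow> bool" where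
  "lin_indep_list d vs \<longleftrightarrow>
     distinct vs \<and> \<not> module.lin_dep class_ring (module_vec TYPE(real) d) (set vs)"

definition rows_lin_indep :: "real mat \<Rightarrow> bool" where
  "rows_lin_indep A \<longleftrightarrow> lin_indep_list (dim_col A) (rows A)"

definition cols_lin_indep :: "real mat \<Rightarrow> bool" where
  "cols_lin_indep A \<longleftrightarrow> lin_indep_list (dim_row A) (cols A)"

end

theory Submission
  imports Defs "HOL-Analysis.Function_Topology" "HOL-Analysis.L2_Norm" "Jordan_Normal_Form.DL_Rank"
begin

text \<open>Both independence conditions yield the strong inner product property: a symmetric
  \<open>X\<close> such that \<open>X Q\<close> vanishes on the support of \<open>Q\<close> is zero. (The orthogonal complement of the
  tangent space at \<open>Q\<close> consists of the matrices \<open>X Q\<close> with \<open>X\<close> symmetric.)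

  Let \<open>\<pi>\<close> be the projection onto the matrices supported on the support of \<open>Q\<close>. To realise a super pattern,
  prescribe the entries \<open>\<epsilon> R\<close> at the zeros of \<open>Q\<close> and look for an orthogonal matrix
  \<open>A = Q + \<epsilon> R + \<pi>(X Q)\<close> with \<open>X\<close> small and symmetric. Minimise the norm of \<open>G X = A A\<^sup>T - I\<close>
  over a small ball. Coercivity of \<open>X \<mapsto> \<pi>(X Q)\<close>, which is the compactness form
  of the strong inner product property, makes \<open>G\<close> larger on the boundary than at the centre, and
  at an interior minimum the first variation in the direction \<open>Y = G X\<close> reads
  \<open>\<langle>Y A, \<pi>(Y Q)\<rangle> = 0\<close>, which by coercivity again forces \<open>Y = 0\<close>.

  The number of rows varies with the statement, so the analysis takes place in the function space
  \<open>nat \<Rightarrow> nat \<Rightarrow> real\<close> with its product topology instead of a Euclidean space type.\<close>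

section \<open>Frobenius inner product\<close>

text \<open>Only the \<open>m \<times> n\<close> block of a function counts; values outside it are
  arbitrary, so equalities of such matrices are meant on the block.\<close>

definition frob_inner :: "nat \<Rightarrow> nat \<Rightarrow> (nat \<Rightarrow> nat \<Rightarrow> real) \<Rightarrow> (nat \<Rightarrow> nat \<Rightarrow> real) \<Rightarrow> real" where
  "frob_inner m n A B = (\<Sum>i<m. \<Sum>j<n. A i j * B i j)"

definition frob_norm :: "nat \<Rightarrow> nat \<Rightarrow> (nat \<Rightarrow> nat \<Rightarrow> real) \<Rightarrow> real" where
  "frob_norm m n A = sqrt (frob_inner m n A A)"

definition mult_fun :: "nat \<Rightarrow> (nat \<Rightarrow> nat \<Rightarrow> real) \<Rightarrow> (nat \<Rightarrow> nat \<Rightarrow> real) \<Rightarrow> nat \<Rightarrow> nat \<Rightarrow> real" where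
  "mult_fun l A B = (\<lambda>i j. \<Sum>k<l. A i k * B k j)"

text \<open>The product of \<open>A\<close> with the transpose of \<open>B\<close>, both having
  \<open>n\<close> columns.\<close>

definition gram_fun :: "nat \<Rightarrow> (nat \<Rightarrow> nat \<Rightarrow> real) \<Rightarrow> (nat \<Rightarrow> nat \<Rightarrow> real) \<Rightarrow> nat \<Rightarrow> nat \<Rightarrow> real" where
  "gram_fun n A B = (\<lambda>i k. \<Sum>j<n. A i j * B k j)"

text \<open>The premise compares products, not factors: a factor may change wherever the other one
  vanishes.\<close>

lemma frob_inner_cong:
  assumes "\<And>i j. i < m \<Longrightarrow> j < n \<Longrightarrow> A i j * B i j = A' i j * B' i j"
  shows "frob_inner m n A B = frob_inner m n A' B'"
  using assms by (simp add: frob_inner_def)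

lemma frob_inner_add_left:
  "frob_inner m n (\<lambda>i j. A i j + B i j) C = frob_inner m n A C + frob_inner m n B C"
  by (simp add: frob_inner_def sum.distrib algebra_simps)

lemma frob_inner_add_right:
  "frob_inner m n C (\<lambda>i j. A i j + B i j) = frob_inner m n C A + frob_inner m n C B"
  by (simp add: frob_inner_def sum.distrib algebra_simps)

lemma frob_inner_self_nonneg: "0 \<le> frob_inner m n A A"
  by (simp add: frob_inner_def sum_nonneg)

lemma frob_norm_nonneg [simp]: "0 \<le> frob_norm m n A"
  by (simp add: frob_norm_def frob_inner_self_nonneg)

lemma frob_norm_square: "(frob_norm m n A)\<^sup>2 = frob_inner m n A A"
  by (simp add: frob_norm_def frob_inner_self_nonneg)

lemma frob_norm_L2_set: "frob_norm m n A = L2_set (\<lambda>(i, j). A i j) ({..<m} \<times> {..<n})"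
  by (simp add: frob_norm_def frob_inner_def L2_set_def sum.cartesian_product power2_eq_square
      case_prod_unfold)

lemma frob_norm_cong:
  assumes "\<And>i j. i < m \<Longrightarrow> j < n \<Longrightarrow> A i j = A' i j"
  shows "frob_norm m n A = frob_norm m n A'"
  unfolding frob_norm_def using frob_inner_cong[of m n A A A' A'] assms by simp

lemma frob_norm_eq_0_iff: "frob_norm m n A = 0 \<longleftrightarrow> (\<forall>i<m. \<forall>j<n. A i j = 0)"
  by (auto simp: frob_norm_L2_set L2_set_eq_0_iff)

lemma frob_norm_triangle:
  "frob_norm m n (\<lambda>i j. A i j + B i j) \<le> frob_norm m n A + frob_norm m n B"
  using L2_set_triangle_ineq[of "\<lambda>(i, j). A i j" "\<lambda>(i, j). B i j" "{..<m} \<times> {..<n}"]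
  by (simp add: frob_norm_L2_set case_prod_unfold)

lemma frob_norm_scale: "frob_norm m n (\<lambda>i j. c * A i j) = \<bar>c\<bar> * frob_norm m n A"
proof -
  have "frob_inner m n (\<lambda>i j. c * A i j) (\<lambda>i j. c * A i j) = c\<^sup>2 * frob_inner m n A A"
    by (simp add: frob_inner_def sum_distrib_left power2_eq_square mult_ac)
  then show ?thesis
    by (simp add: frob_norm_def real_sqrt_mult)
qed

lemma abs_entry_le_frob_norm:
  assumes "i < m" "j < n"
  shows "\<bar>A i j\<bar> \<le> frob_norm m n A"
proof -
  have "L2_set (\<lambda>(i, j). \<bar>A i j\<bar>) ({..<m} \<times> {..<n}) = frob_norm m n A"
    by (simp add: frob_norm_L2_set L2_set_def case_prod_unfold)
  with member_le_L2_set[of "{..<m} \<times> {..<n}" "(i, j)" "\<lambda>(i, j). \<bar>A i j\<bar>"] assms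
  show ?thesis by simp
qed

lemma frob_Cauchy_Schwarz: "\<bar>frob_inner m n A B\<bar> \<le> frob_norm m n A * frob_norm m n B"
proof -
  have "\<bar>frob_inner m n A B\<bar> \<le> (\<Sum>p\<in>{..<m} \<times> {..<n}. \<bar>A (fst p) (snd p) * B (fst p) (snd p)\<bar>)"
    unfolding frob_inner_def sum.cartesian_product case_prod_unfold by (rule sum_abs)
  also have "\<dots> \<le> frob_norm m n A * frob_norm m n B"
    unfolding frob_norm_L2_set case_prod_unfold abs_mult by (rule L2_set_mult_ineq)
  finally show ?thesis .
qed

lemma Cauchy_Schwarz_sum_square:
  fixes f g :: "'a \<Rightarrow> real"
  shows "(\<Sum>i\<in>I. f i * g i)\<^sup>2 \<le> (\<Sum>i\<in>I. (f i)\<^sup>2) * (\<Sum>i\<in>I. (g i)\<^sup>2)"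
proof -
  have "\<bar>\<Sum>i\<in>I. f i * g i\<bar> \<le> (\<Sum>i\<in>I. \<bar>f i * g i\<bar>)"
    by (rule sum_abs)
  also have "\<dots> \<le> L2_set f I * L2_set g I"
    unfolding abs_mult by (rule L2_set_mult_ineq)
  finally have "(\<Sum>i\<in>I. f i * g i)\<^sup>2 \<le> (L2_set f I * L2_set g I)\<^sup>2"
    by (metis abs_le_square_iff abs_of_nonneg L2_set_nonneg mult_nonneg_nonneg)
  then show ?thesis
    by (simp add: power_mult_distrib L2_set_def sum_nonneg)
qed

lemma frob_inner_self: "frob_inner m n A A = (\<Sum>i<m. \<Sum>j<n. (A i j)\<^sup>2)"
  by (simp add: frob_inner_def power2_eq_square)

text \<open>Cauchy-Schwarz on each entry bounds the square by a double sum that factors into row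
  sums of \<open>A\<close> and column sums of \<open>B\<close>.\<close>

lemma frob_norm_mult_fun_le:
  "frob_norm m n (mult_fun l A B) \<le> frob_norm m l A * frob_norm l n B"
proof -
  have "(frob_norm m n (mult_fun l A B))\<^sup>2
      \<le> (\<Sum>i<m. \<Sum>j<n. (\<Sum>k<l. (A i k)\<^sup>2) * (\<Sum>k<l. (B k j)\<^sup>2))"
    unfolding frob_norm_square frob_inner_self mult_fun_def
    by (intro sum_mono Cauchy_Schwarz_sum_square)
  also have "\<dots> = (\<Sum>i<m. \<Sum>k<l. (A i k)\<^sup>2) * (\<Sum>j<n. \<Sum>k<l. (B k j)\<^sup>2)"
    by (simp add: sum_product)
  also have "(\<Sum>j<n. \<Sum>k<l. (B k j)\<^sup>2) = (\<Sum>k<l. \<Sum>j<n. (B k j)\<^sup>2)"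
    by (rule sum.swap)
  finally have "(frob_norm m n (mult_fun l A B))\<^sup>2 \<le> (frob_norm m l A * frob_norm l n B)\<^sup>2"
    by (simp add: power_mult_distrib frob_norm_square frob_inner_self)
  then show ?thesis
    by (rule power2_le_imp_le) simp
qed

lemma frob_norm_gram_fun_le:
  "frob_norm m l (gram_fun n A B) \<le> frob_norm m n A * frob_norm l n B"
proof -
  have "(frob_norm m l (gram_fun n A B))\<^sup>2
      \<le> (\<Sum>i<m. \<Sum>k<l. (\<Sum>j<n. (A i j)\<^sup>2) * (\<Sum>j<n. (B k j)\<^sup>2))"
    unfolding frob_norm_square frob_inner_self gram_fun_def
    by (intro sum_mono Cauchy_Schwarz_sum_square)
  also have "\<dots> = (frob_norm m n A * frob_norm l n B)\<^sup>2"
    by (simp add: sum_product power_mult_distrib frob_norm_square frob_inner_self)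
  finally show ?thesis
    by (rule power2_le_imp_le) simp
qed

text \<open>Right multiplication by \<open>B\<close> has right multiplication by the transpose of
  \<open>B\<close> as its adjoint.\<close>

lemma frob_inner_mult_fun:
  "frob_inner m n (mult_fun l X B) A = frob_inner m l X (gram_fun n A B)"
proof -
  have "frob_inner m n (mult_fun l X B) A = (\<Sum>i<m. \<Sum>j<n. \<Sum>k<l. X i k * (A i j * B k j))"
    unfolding frob_inner_def mult_fun_def sum_distrib_right
    by (intro sum.cong refl) (simp add: mult_ac)
  also have "\<dots> = (\<Sum>i<m. \<Sum>k<l. \<Sum>j<n. X i k * (A i j * B k j))"
    by (intro sum.cong refl sum.swap)
  finally show ?thesis
    by (simp add: frob_inner_def gram_fun_def sum_distrib_left)
qed

text \<open>The two Gram matrices are transposes of each other, and transposition preserves the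
  inner product and fixes \<open>X\<close>.\<close>

lemma frob_inner_gram_fun_swap:
  assumes "\<And>i k. i < m \<Longrightarrow> k < m \<Longrightarrow> X i k = X k i"
  shows "frob_inner m m X (gram_fun n A B) = frob_inner m m X (gram_fun n B A)"
proof -
  have "frob_inner m m X (gram_fun n A B) = (\<Sum>k<m. \<Sum>i<m. X i k * gram_fun n A B i k)"
    unfolding frob_inner_def by (rule sum.swap)
  also have "\<dots> = frob_inner m m X (gram_fun n B A)"
    unfolding frob_inner_def
    by (intro sum.cong refl) (simp add: assms gram_fun_def mult.commute)
  finally show ?thesis .
qed

lemma gram_fun_mult_fun:
  "gram_fun n (mult_fun l X A) B i k = (\<Sum>h<l. X i h * gram_fun n A B h k)"
proof -
  have "gram_fun n (mult_fun l X A) B i k = (\<Sum>j<n. \<Sum>h<l. X i h * (A h j * B k j))"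
    by (simp add: gram_fun_def mult_fun_def sum_distrib_right mult.assoc)
  also have "\<dots> = (\<Sum>h<l. X i h * gram_fun n A B h k)"
    by (subst sum.swap) (simp add: gram_fun_def sum_distrib_left)
  finally show ?thesis .
qed

text \<open>By adjointness the squared norm of \<open>X Q\<close> is the inner product of
  \<open>X\<close> with \<open>X Q Q\<^sup>T\<close>, which is \<open>X\<close> since the rows of
  \<open>Q\<close> are orthonormal.\<close>

lemma frob_norm_mult_fun_orthogonal:
  assumes "\<And>i k. i < l \<Longrightarrow> k < l \<Longrightarrow> gram_fun n Q Q i k = (if i = k then 1 else 0)"
  shows "frob_norm m n (mult_fun l X Q) = frob_norm m l X"
proof -
  have "gram_fun n (mult_fun l X Q) Q i k = X i k" if "k < l" for i k
  proof -
    have "gram_fun n (mult_fun l X Q) Q i k = (\<Sum>h<l. if h = k then X i h else 0)"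
      unfolding gram_fun_mult_fun using that by (intro sum.cong) (auto simp: assms)
    then show ?thesis
      using that by simp
  qed
  then have "frob_inner m n (mult_fun l X Q) (mult_fun l X Q) = frob_inner m l X X"
    unfolding frob_inner_mult_fun by (intro frob_inner_cong) simp
  then show ?thesis
    by (simp add: frob_norm_def)
qed

section \<open>Perturbation of orthogonal matrices\<close>

lemma compact_Pi_UNIV:
  fixes K :: "'a \<Rightarrow> 'b::topological_space set"
  assumes "\<And>i. compact (K i)"
  shows "compact {f. \<forall>i. f i \<in> K i}"
proof -
  \<comment> \<open>Tychonoff's theorem, carried over to the type class topology on
    functions.\<close>
  have "compactin (product_topology (\<lambda>i. euclidean) UNIV) (PiE UNIV K)"
    using assms by (auto simp: compactin_PiE)
  moreover have "PiE UNIV K = {f. \<forall>i. f i \<in> K i}"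
    by auto
  ultimately show ?thesis
    by (simp add: euclidean_product_topology)
qed

lemma continuous_on_matrix_entry [continuous_intros]:
  "continuous_on S (\<lambda>X :: nat \<Rightarrow> nat \<Rightarrow> real. X i j)"
  by (rule continuous_on_product_then_coordinatewise[OF
        continuous_on_product_then_coordinatewise[OF continuous_on_id]])

lemma continuous_on_frob_norm [continuous_intros]:
  assumes "\<And>i j. continuous_on S (\<lambda>x. F x i j)"
  shows "continuous_on S (\<lambda>x. frob_norm m n (F x))"
  unfolding frob_norm_def frob_inner_def by (intro continuous_intros assms)

text \<open>The norm does not see entries outside the block; forcing them to be zero is what makes
  the ball compact.\<close>

definition sym_ball :: "nat \<Rightarrow> real \<Rightarrow> (nat \<Rightarrow> nat \<Rightarrow> real) set" where
  "sym_ball m r = {X. (\<forall>i k. X i k = X k i) \<and> (\<forall>i k. \<not> (i < m \<and> k < m) \<longrightarrow> X i k = 0) \<and>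
     frob_norm m m X \<le> r}"

text \<open>The ball is a closed subset of a product of compact intervals, because every entry is
  bounded by the norm or is zero.\<close>

lemma compact_sym_ball: "compact (sym_ball m r)"
proof -
  define K where "K = {X :: nat \<Rightarrow> nat \<Rightarrow> real. \<forall>i. X i \<in> {x. \<forall>k. x k \<in> {-\<bar>r\<bar>..\<bar>r\<bar>}}}"
  have "compact K"
    unfolding K_def by (intro compact_Pi_UNIV) simp
  moreover have "closed (sym_ball m r)"
    unfolding sym_ball_def
    by (intro closed_Collect_conj closed_Collect_all closed_Collect_imp open_Collect_const
        closed_Collect_eq closed_Collect_le continuous_intros)
  moreover have "sym_ball m r \<subseteq> K"
  proof
    fix X assume X: "X \<in> sym_ball m r"
    have "\<bar>X i k\<bar> \<le> \<bar>r\<bar>" for i k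
      using X abs_entry_le_frob_norm[of i m k m X] by (cases "i < m \<and> k < m") (auto simp: sym_ball_def)
    then show "X \<in> K"
      by (auto simp: K_def abs_le_iff minus_le_iff)
  qed
  ultimately show ?thesis
    using compact_Int_closed[of K "sym_ball m r"] by (simp add: Int_absorb1)
qed


text \<open>Along the curve \<open>G + t M + t\<^sup>2 N\<close> the squared norm is a quartic in
  \<open>t\<close> with a local minimum at 0, where its derivative is twice the inner product of
  \<open>G\<close> and \<open>M\<close>.\<close>

lemma frob_first_variation:
  assumes "0 < d"
    and min: "\<And>t. \<bar>t\<bar> < d \<Longrightarrow>
      frob_inner m n G G \<le> frob_inner m n (\<lambda>i j. G i j + (t * M i j + t\<^sup>2 * N i j))
        (\<lambda>i j. G i j + (t * M i j + t\<^sup>2 * N i j))"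
  shows "frob_inner m n G M = 0"
proof -
  define \<phi> where "\<phi> t = frob_inner m n G G + 2 * t * frob_inner m n G M
    + t\<^sup>2 * frob_inner m n M M + 2 * t\<^sup>2 * frob_inner m n G N + 2 * t ^ 3 * frob_inner m n M N
    + t ^ 4 * frob_inner m n N N" for t
  have expand: "frob_inner m n (\<lambda>i j. G i j + (t * M i j + t\<^sup>2 * N i j))
      (\<lambda>i j. G i j + (t * M i j + t\<^sup>2 * N i j)) = \<phi> t" for t
  proof -
    have "(G i j + (t * M i j + t\<^sup>2 * N i j)) * (G i j + (t * M i j + t\<^sup>2 * N i j)) =
        G i j * G i j + 2 * t * (G i j * M i j)
        + t\<^sup>2 * (M i j * M i j) + 2 * t\<^sup>2 * (G i j * N i j) + 2 * t ^ 3 * (M i j * N i j)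
        + t ^ 4 * (N i j * N i j)" for i j
      by (simp add: algebra_simps power2_eq_square power3_eq_cube power4_eq_xxxx)
    then show ?thesis
      by (simp add: frob_inner_def \<phi>_def sum.distrib sum_distrib_left)
  qed
  have "(\<phi> has_real_derivative 2 * frob_inner m n G M) (at 0)"
    unfolding \<phi>_def by (auto intro!: derivative_eq_intros)
  moreover have "\<forall>t. \<bar>0 - t\<bar> < d \<longrightarrow> \<phi> 0 \<le> \<phi> t"
    using min by (auto simp: expand) (simp add: \<phi>_def)
  ultimately have "2 * frob_inner m n G M = 0"
    using \<open>0 < d\<close> DERIV_local_min by blast
  then show ?thesis
    by simp
qed

section \<open>Support projection and coercivity\<close>

definition restrict_supp ::
  "(nat \<Rightarrow> nat \<Rightarrow> real) \<Rightarrow> (nat \<Rightarrow> nat \<Rightarrow> real) \<Rightarrow> nat \<Rightarrow> nat \<Rightarrow> real" where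
  "restrict_supp Q A = (\<lambda>i j. if Q i j = 0 then 0 else A i j)"

text \<open>When \<open>Q\<close> has orthonormal rows, this is transversality at \<open>Q\<close>:
  no nonzero normal vector \<open>X Q\<close> of the matrices with orthonormal rows is orthogonal to
  all matrices supported on the support of \<open>Q\<close>.\<close>

definition strong_inner_product_property :: "nat \<Rightarrow> nat \<Rightarrow> (nat \<Rightarrow> nat \<Rightarrow> real) \<Rightarrow> bool" where
  "strong_inner_product_property m n Q \<longleftrightarrow>
     (\<forall>X. (\<forall>i<m. \<forall>k<m. X i k = X k i) \<longrightarrow>
          (\<forall>i<m. \<forall>j<n. Q i j \<noteq> 0 \<longrightarrow> mult_fun m X Q i j = 0) \<longrightarrow>
          (\<forall>i<m. \<forall>k<m. X i k = 0))"

text \<open>\<open>N\<close> is continuous and positive on the compact unit sphere of symmetric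
  matrices, so it has a positive lower bound there, and homogeneity extends the estimate. The cap
  \<open>c \<le> 1\<close> serves to have \<open>c\<^sup>2 \<le> c\<close> later.\<close>

lemma strong_inner_product_property_coercive:
  assumes "strong_inner_product_property m n Q"
  obtains c where "0 < c" "c \<le> 1"
    "\<And>X. (\<And>i k. i < m \<Longrightarrow> k < m \<Longrightarrow> X i k = X k i) \<Longrightarrow>
      c * frob_norm m m X \<le> frob_norm m n (restrict_supp Q (mult_fun m X Q))"
proof -
  define N where "N X = frob_norm m n (restrict_supp Q (mult_fun m X Q))" for X
  define K where "K = sym_ball m 1 \<inter> {X. frob_norm m m X = 1}"
  have "continuous_on S (\<lambda>X. restrict_supp Q (mult_fun m X Q) i j)" for S i j
    by (cases "Q i j = 0") (auto simp: restrict_supp_def mult_fun_def intro!: continuous_intros)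
  then have contN: "continuous_on S N" for S
    unfolding N_def by (rule continuous_on_frob_norm)
  have "compact K"
    unfolding K_def
    by (intro compact_Int_closed compact_sym_ball closed_Collect_eq continuous_intros)
  have pos: "0 < N X" if "X \<in> K" for X
  proof (rule ccontr)
    assume "\<not> 0 < N X"
    then have "N X = 0"
      by (metis N_def frob_norm_nonneg less_eq_real_def)
    then have "\<forall>i<m. \<forall>j<n. Q i j \<noteq> 0 \<longrightarrow> mult_fun m X Q i j = 0"
      by (auto simp: N_def frob_norm_eq_0_iff restrict_supp_def split: if_splits)
    with that assms have "\<forall>i<m. \<forall>k<m. X i k = 0"
      unfolding strong_inner_product_property_def K_def sym_ball_def by blast
    then have "frob_norm m m X = 0"
      by (simp add: frob_norm_eq_0_iff)
    with that show False
      by (simp add: K_def)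
  qed
  obtain c where c: "0 < c" "c \<le> 1" "\<And>X. X \<in> K \<Longrightarrow> c \<le> N X"
  \<comment> \<open>The sphere is empty for \<open>m = 0\<close>, where any positive constant
    serves.\<close>
  proof (cases "K = {}")
    case True
    then show ?thesis
      using that[of 1] by simp
  next
    case False
    then obtain X0 where "X0 \<in> K" "\<And>X. X \<in> K \<Longrightarrow> N X0 \<le> N X"
      using continuous_attains_inf[OF \<open>compact K\<close> _ contN] by blast
    with pos[of X0] show ?thesis
      by (intro that[of "min 1 (N X0)"]) (auto intro: min.coboundedI2)
  qed
  have "c * frob_norm m m X \<le> N X"
    if sym: "\<And>i k. i < m \<Longrightarrow> k < m \<Longrightarrow> X i k = X k i" for X
  proof (cases "frob_norm m m X = 0")
    case True
    then show ?thesis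
      by (simp add: N_def)
  next
    case False
    define s where "s = frob_norm m m X"
    have "0 < s"
      using False frob_norm_nonneg[of m m X] unfolding s_def by linarith
    \<comment> \<open>Besides normalising, this cuts \<open>X\<close> off outside the block, as
      \<open>sym_ball\<close> demands; \<open>N\<close> does not see the cut.\<close>
    define X' where "X' = (\<lambda>i k. if i < m \<and> k < m then (1 / s) * X i k else 0)"
    have "frob_norm m m X' = frob_norm m m (\<lambda>i k. (1 / s) * X i k)"
      by (rule frob_norm_cong) (simp add: X'_def)
    also have "\<dots> = 1"
      using \<open>0 < s\<close> unfolding frob_norm_scale by (simp add: s_def)
    finally have "X' \<in> K"
      using sym by (auto simp: K_def sym_ball_def X'_def)
    have "N X' = frob_norm m n (\<lambda>i j. (1 / s) * restrict_supp Q (mult_fun m X Q) i j)"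
      unfolding N_def
      by (rule frob_norm_cong) (simp add: restrict_supp_def mult_fun_def X'_def sum_divide_distrib)
    also have "\<dots> = N X / s"
      using \<open>0 < s\<close> unfolding frob_norm_scale by (simp add: N_def)
    finally show ?thesis
      using c(3)[OF \<open>X' \<in> K\<close>] \<open>0 < s\<close> by (simp add: field_simps s_def)
  qed
  with c show ?thesis
    by (intro that[of c]) (auto simp: N_def)
qed

text \<open>\<open>restrict_supp Q\<close> is an orthogonal projection.\<close>

lemma frob_inner_restrict_supp:
  "frob_inner m n A (restrict_supp Q A) = (frob_norm m n (restrict_supp Q A))\<^sup>2"
  unfolding frob_norm_square by (rule frob_inner_cong) (simp add: restrict_supp_def)

lemma frob_norm_restrict_supp_le: "frob_norm m n (restrict_supp Q A) \<le> frob_norm m n A"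
  unfolding frob_norm_L2_set L2_set_def
  by (intro real_sqrt_le_mono sum_mono) (auto simp: restrict_supp_def)

text \<open>The minimisation takes the place of an implicit function theorem: the entries at the
  zeros of \<open>Q\<close> are prescribed, and those on its support adjust by less than \<delta> to
  restore orthogonality.\<close>

theorem strong_inner_product_property_extension:
  assumes orth: "\<And>i k. i < m \<Longrightarrow> k < m \<Longrightarrow> gram_fun n Q Q i k = (if i = k then 1 else 0)"
    and sipp: "strong_inner_product_property m n Q"
    and "0 < \<delta>"
  obtains A \<epsilon> where "0 < \<epsilon>"
    "\<And>i k. i < m \<Longrightarrow> k < m \<Longrightarrow> gram_fun n A A i k = (if i = k then 1 else 0)"
    "\<And>i j. i < m \<Longrightarrow> j < n \<Longrightarrow> Q i j = 0 \<Longrightarrow> A i j = \<epsilon> * R i j"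
    "\<And>i j. i < m \<Longrightarrow> j < n \<Longrightarrow> Q i j \<noteq> 0 \<Longrightarrow> \<bar>A i j - Q i j\<bar> < \<delta>"
proof -
  obtain c where c: "0 < c" "c \<le> 1"
    and coercive: "\<And>X. (\<And>i k. i < m \<Longrightarrow> k < m \<Longrightarrow> X i k = X k i) \<Longrightarrow>
      c * frob_norm m m X \<le> frob_norm m n (restrict_supp Q (mult_fun m X Q))"
    using strong_inner_product_property_coercive[OF sipp] by metis
  \<comment> \<open>The first bound gives \<open>(2 * r)\<^sup>2 \<le> c\<^sup>2 * r\<close>, which
    controls the quadratic term on the sphere; the second gives \<open>2 * r < \<delta>\<close>,
    where \<open>2 * r\<close> bounds the final displacement.\<close>
  define r where "r = min (c\<^sup>2 / 4) (\<delta> / 4)"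
  have r: "0 < r" "r \<le> c\<^sup>2 / 4" "r < \<delta> / 2"
    using c \<open>0 < \<delta>\<close> by (auto simp: r_def min_def)
  have "c\<^sup>2 \<le> c"
    using c by (simp add: power2_eq_square mult_left_le)
  define q where "q = frob_norm m n Q"
  have "0 \<le> q"
    by (simp add: q_def)
  define R' where "R' = (\<lambda>i j. if Q i j = 0 then R i j else 0)"
  define b where "b = frob_norm m n R'"
  have "0 \<le> b"
    by (simp add: b_def)
  \<comment> \<open>Chosen for \<open>(2 * q + 3) * \<rho> < c\<^sup>2 * r\<close>: the residual at
    the centre costs \<open>2 * q + 1\<close>, the cross term on the sphere costs 2. The summand 1
    in \<open>b + 1\<close> covers \<open>b = 0\<close>.\<close>
  define \<epsilon> where "\<epsilon> = c\<^sup>2 * r / ((2 * q + 3) * (b + 1))"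
  have "0 < \<epsilon>"
    using c r \<open>0 \<le> q\<close> \<open>0 \<le> b\<close> by (simp add: \<epsilon>_def)
  define E where "E = (\<lambda>i j. \<epsilon> * R' i j)"
  define \<rho> where "\<rho> = frob_norm m n E"
  have "0 \<le> \<rho>"
    by (simp add: \<rho>_def)
  have "\<rho> = \<epsilon> * b"
    using \<open>0 < \<epsilon>\<close> by (simp add: \<rho>_def E_def frob_norm_scale b_def)
  moreover have "2 * q + 3 \<noteq> 0"
    using \<open>0 \<le> q\<close> by linarith
  ultimately have "(2 * q + 3) * \<rho> = c\<^sup>2 * r * (b / (b + 1))"
    by (simp add: \<epsilon>_def)
  also have "\<dots> < c\<^sup>2 * r * 1"
    using c r \<open>0 \<le> b\<close> by (intro mult_strict_left_mono) auto
  finally have rho_small: "(2 * q + 3) * \<rho> < c\<^sup>2 * r"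
    by simp
  have "c\<^sup>2 * r \<le> 1 * r"
    using c r \<open>c\<^sup>2 \<le> c\<close> by (intro mult_right_mono) auto
  moreover have "\<rho> \<le> (2 * q + 3) * \<rho>"
    using mult_right_mono[of 1 "2 * q + 3" \<rho>] \<open>0 \<le> q\<close> \<open>0 \<le> \<rho>\<close> by simp
  ultimately have "\<rho> \<le> r"
    using rho_small by linarith

  \<comment> \<open>\<open>D X\<close> is the displacement from \<open>Q\<close>: the prescribed
    part \<open>E\<close> plus the projected normal vector \<open>W X\<close>. On the block,
    \<open>G X\<close> is \<open>(Q + D X) (Q + D X)\<^sup>T - I\<close>, since
    \<open>Q Q\<^sup>T = I\<close>.\<close>
  define W where "W X = restrict_supp Q (mult_fun m X Q)" for X
  define D where "D X = (\<lambda>i j. E i j + W X i j)" for X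
  define G where "G X = (\<lambda>i k. gram_fun n (D X) (D X) i k
    + (gram_fun n (D X) Q i k + gram_fun n Q (D X) i k))" for X
  have norm_D: "frob_norm m n (D X) \<le> \<rho> + frob_norm m m X" for X
  proof -
    have "frob_norm m n (W X) \<le> frob_norm m n (mult_fun m X Q)"
      unfolding W_def by (rule frob_norm_restrict_supp_le)
    also have "\<dots> = frob_norm m m X"
      using orth by (rule frob_norm_mult_fun_orthogonal)
    finally show ?thesis
      using frob_norm_triangle[of m n E "W X"] by (simp add: D_def \<rho>_def)
  qed

  \<comment> \<open>At the centre the displacement is \<open>E\<close>, and
    \<open>\<rho> \<le> 1\<close> lets the quadratic term be bounded linearly.\<close>
  have norm_G0: "frob_norm m m (G (\<lambda>i k. 0)) \<le> (2 * q + 1) * \<rho>"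
  proof -
    have D0: "D (\<lambda>i k. 0) = E"
      by (auto simp: D_def W_def restrict_supp_def mult_fun_def fun_eq_iff)
    have "frob_norm m m (G (\<lambda>i k. 0)) \<le> frob_norm m m (gram_fun n E E)
        + (frob_norm m m (gram_fun n E Q) + frob_norm m m (gram_fun n Q E))"
      unfolding G_def D0 by (intro order_trans[OF frob_norm_triangle] add_mono order_refl)
    also have "\<dots> \<le> \<rho> * \<rho> + (\<rho> * q + q * \<rho>)"
      unfolding \<rho>_def q_def by (intro add_mono frob_norm_gram_fun_le)
    also have "\<dots> \<le> 1 * \<rho> + (\<rho> * q + q * \<rho>)"
      using \<open>\<rho> \<le> r\<close> r \<open>c\<^sup>2 \<le> c\<close> c \<open>0 \<le> \<rho>\<close> by (intro add_mono mult_right_mono order_refl) linarith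
    finally show ?thesis
      by (simp add: algebra_simps)
  qed

  \<comment> \<open>Pair \<open>G X\<close> with \<open>X\<close>. The linear part contributes at
    least \<open>2 * (c * r)\<^sup>2 - 2 * r * \<rho>\<close> by coercivity, the quadratic part at
    least \<open>- r * (c\<^sup>2 * r)\<close>; dividing by \<open>r\<close> leaves
    \<open>c\<^sup>2 * r - 2 * \<rho>\<close>, which exceeds the bound at the centre.\<close>
  have norm_G_sphere: "(2 * q + 1) * \<rho> < frob_norm m m (G X)"
    if sym: "\<And>i k. i < m \<Longrightarrow> k < m \<Longrightarrow> X i k = X k i" and X: "frob_norm m m X = r" for X
  proof -
    have "frob_norm m n (D X) \<le> 2 * r"
      using norm_D[of X] X \<open>\<rho> \<le> r\<close> by simp
    then have "frob_norm m n (D X) * frob_norm m n (D X) \<le> (2 * r) * (2 * r)"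
      using r by (intro mult_mono) auto
    also have "\<dots> \<le> c\<^sup>2 * r"
      using r mult_right_mono[of "4 * r" "c\<^sup>2" r] by simp
    finally have "frob_norm m n (D X) * frob_norm m n (D X) \<le> c\<^sup>2 * r" .
    then have "frob_norm m m (gram_fun n (D X) (D X)) \<le> c\<^sup>2 * r"
      using frob_norm_gram_fun_le[of m m n "D X" "D X"] by linarith
    then have "frob_norm m m X * frob_norm m m (gram_fun n (D X) (D X)) \<le> r * (c\<^sup>2 * r)"
      using X r by simp
    then have DD: "- (r * (c\<^sup>2 * r)) \<le> frob_inner m m X (gram_fun n (D X) (D X))"
      using frob_Cauchy_Schwarz[of m m X "gram_fun n (D X) (D X)"] by linarith
    have "\<bar>frob_inner m n (mult_fun m X Q) E\<bar> \<le> r * \<rho>"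
      using frob_Cauchy_Schwarz[of m n "mult_fun m X Q" E] X
      by (simp add: frob_norm_mult_fun_orthogonal[OF orth] \<rho>_def)
    moreover have "(c * r)\<^sup>2 \<le> (frob_norm m n (W X))\<^sup>2"
      using coercive[OF sym] X c r by (intro power_mono) (auto simp: W_def)
    moreover have "frob_inner m n (mult_fun m X Q) (D X)
        = frob_inner m n (mult_fun m X Q) E + (frob_norm m n (W X))\<^sup>2"
      by (simp add: D_def frob_inner_add_right W_def frob_inner_restrict_supp)
    ultimately have DQ: "(c * r)\<^sup>2 - r * \<rho> \<le> frob_inner m n (mult_fun m X Q) (D X)"
      by linarith
    have "frob_inner m m X (G X) = frob_inner m m X (gram_fun n (D X) (D X))
        + 2 * frob_inner m n (mult_fun m X Q) (D X)"
      using frob_inner_gram_fun_swap[of m X n Q "D X", OF sym]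
      by (simp add: G_def frob_inner_add_right frob_inner_mult_fun)
    then have "r * (c\<^sup>2 * r - 2 * \<rho>) \<le> frob_inner m m X (G X)"
      using DD DQ by (simp add: power2_eq_square algebra_simps)
    also have "\<dots> \<le> r * frob_norm m m (G X)"
      using frob_Cauchy_Schwarz[of m m X "G X"] X by simp
    finally have "c\<^sup>2 * r - 2 * \<rho> \<le> frob_norm m m (G X)"
      using r by simp
    then show ?thesis
      using rho_small by (simp add: algebra_simps)
  qed

  have "continuous_on S (\<lambda>X. W X i j)" for S i j
    unfolding W_def
    by (cases "Q i j = 0") (auto simp: restrict_supp_def mult_fun_def intro!: continuous_intros)
  then have "continuous_on (sym_ball m r) (\<lambda>X. frob_norm m m (G X))"
    unfolding G_def gram_fun_def D_def by (intro continuous_intros)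
  moreover have zero: "(\<lambda>i k. 0) \<in> sym_ball m r"
    using r frob_norm_eq_0_iff[of m m "\<lambda>i k. 0"] by (simp add: sym_ball_def)
  ultimately obtain X where X: "X \<in> sym_ball m r"
    and X_min: "\<And>X'. X' \<in> sym_ball m r \<Longrightarrow> frob_norm m m (G X) \<le> frob_norm m m (G X')"
    using continuous_attains_inf[OF compact_sym_ball] by (metis empty_iff)
  \<comment> \<open>The residual at the centre is smaller than on the whole sphere, so the minimiser
    is interior and can be varied in every symmetric direction.\<close>
  have "frob_norm m m X \<noteq> r"
    using X norm_G_sphere[of X] X_min[OF zero] norm_G0 by (force simp: sym_ball_def)
  with X have "frob_norm m m X < r"
    by (simp add: sym_ball_def)
  have norm_DX: "frob_norm m n (D X) < 2 * r"
    using norm_D[of X] \<open>frob_norm m m X < r\<close> \<open>\<rho> \<le> r\<close> by linarith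

  define A where "A = (\<lambda>i j. Q i j + D X i j)"
  define H where "H = (\<lambda>i k. if i < m \<and> k < m then G X i k else 0)"
  define V where "V = W H"
  have H_sym: "H i k = H k i" for i k
    by (simp add: H_def G_def gram_fun_def mult.commute add.commute)
  \<comment> \<open>\<open>D\<close> is affine, so \<open>G\<close> is quadratic along the line;
    \<open>V\<close> is the derivative of \<open>D\<close> in the direction
    \<open>H\<close>.\<close>
  have G_line: "G (\<lambda>i k. X i k + t * H i k) = (\<lambda>i k. G X i k
      + (t * (gram_fun n V A i k + gram_fun n A V i k) + t\<^sup>2 * gram_fun n V V i k))" for t
  proof -
    have D_line: "D (\<lambda>i k. X i k + t * H i k) = (\<lambda>i j. D X i j + t * V i j)"
      by (auto simp: D_def V_def W_def restrict_supp_def mult_fun_def fun_eq_iff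
          sum.distrib sum_distrib_left algebra_simps)
    show ?thesis
      unfolding G_def D_line A_def gram_fun_def
      by (simp add: fun_eq_iff sum.distrib sum_distrib_left algebra_simps power2_eq_square)
  qed
  \<comment> \<open>The residual itself, cut off outside the \<open>m \<times> m\<close> block, is the test direction.\<close>
  have "frob_inner m m (G X) (\<lambda>i k. gram_fun n V A i k + gram_fun n A V i k) = 0"
  proof (rule frob_first_variation)
    \<comment> \<open>Keeps \<open>X + t H\<close> inside the ball; the summand 1 covers
      \<open>H = 0\<close>.\<close>
    define d where "d = (r - frob_norm m m X) / (frob_norm m m H + 1)"
    have "0 < frob_norm m m H + 1"
      using frob_norm_nonneg[of m m H] by linarith
    then show "0 < d"
      using \<open>frob_norm m m X < r\<close> by (simp add: d_def)
    fix t :: real assume "\<bar>t\<bar> < d"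
    have "\<bar>t\<bar> * frob_norm m m H \<le> d * (frob_norm m m H + 1)"
      using \<open>\<bar>t\<bar> < d\<close> by (intro mult_mono) auto
    also have "\<dots> = r - frob_norm m m X"
      using \<open>0 < frob_norm m m H + 1\<close> by (simp add: d_def)
    finally have "frob_norm m m (\<lambda>i k. X i k + t * H i k) \<le> r"
      using frob_norm_triangle[of m m X "\<lambda>i k. t * H i k"] by (simp add: frob_norm_scale)
    moreover have "X i k = X k i" for i k
      using X by (simp add: sym_ball_def)
    ultimately have "(\<lambda>i k. X i k + t * H i k) \<in> sym_ball m r"
      using X H_sym by (auto simp: sym_ball_def H_def)
    from X_min[OF this] show "frob_inner m m (G X) (G X) \<le> frob_inner m m
        (\<lambda>i k. G X i k + (t * (gram_fun n V A i k + gram_fun n A V i k) + t\<^sup>2 * gram_fun n V V i k))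
        (\<lambda>i k. G X i k + (t * (gram_fun n V A i k + gram_fun n A V i k) + t\<^sup>2 * gram_fun n V V i k))"
      by (simp add: G_line frob_norm_def)
  qed
  moreover have "frob_inner m m (G X) (\<lambda>i k. gram_fun n V A i k + gram_fun n A V i k)
      = frob_inner m m H (\<lambda>i k. gram_fun n V A i k + gram_fun n A V i k)"
    by (rule frob_inner_cong) (simp add: H_def)
  moreover have "frob_inner m m H (gram_fun n A V) = frob_inner m m H (gram_fun n V A)"
    by (rule frob_inner_gram_fun_swap) (rule H_sym)
  \<comment> \<open>Symmetry of \<open>H\<close> makes both terms of the variation equal to this
    inner product.\<close>
  ultimately have "frob_inner m n (mult_fun m H A) V = 0"
    by (simp add: frob_inner_add_right frob_inner_mult_fun)
  moreover have "mult_fun m H A = (\<lambda>i j. mult_fun m H Q i j + mult_fun m H (D X) i j)"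
    by (simp add: mult_fun_def A_def fun_eq_iff sum.distrib algebra_simps)
  \<comment> \<open>Split \<open>A = Q + D X\<close>: as \<open>V\<close> is the projection of
    \<open>H Q\<close>, the \<open>Q\<close> part yields the squared norm of
    \<open>V\<close>.\<close>
  ultimately have "(frob_norm m n V)\<^sup>2 = - frob_inner m n (mult_fun m H (D X)) V"
    by (simp add: frob_inner_add_left V_def W_def frob_inner_restrict_supp)
  also have "\<dots> \<le> frob_norm m n (mult_fun m H (D X)) * frob_norm m n V"
    using frob_Cauchy_Schwarz[of m n "mult_fun m H (D X)" V] by linarith
  also have "\<dots> \<le> frob_norm m m H * frob_norm m n (D X) * frob_norm m n V"
    by (intro mult_right_mono frob_norm_mult_fun_le) simp
  finally have V_le: "frob_norm m n V * frob_norm m n V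
      \<le> frob_norm m m H * frob_norm m n (D X) * frob_norm m n V"
    by (simp add: power2_eq_square)
  have V_ge: "c * frob_norm m m H \<le> frob_norm m n V"
    unfolding V_def W_def by (rule coercive) (rule H_sym)
  \<comment> \<open>Otherwise cancelling the norms of \<open>V\<close> and \<open>H\<close> gives
    \<open>c \<le> frob_norm m n (D X) < 2 * r \<le> c\<^sup>2 / 2 \<le> c / 2\<close>.\<close>
  have "frob_norm m m H = 0"
  proof (rule ccontr)
    assume "frob_norm m m H \<noteq> 0"
    then have H_pos: "0 < frob_norm m m H"
      by (simp add: less_le)
    then have "0 < frob_norm m n V"
      using V_ge c mult_pos_pos[of c "frob_norm m m H"] by linarith
    with V_le have "frob_norm m n V \<le> frob_norm m m H * frob_norm m n (D X)"
      by simp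
    with V_ge have "frob_norm m m H * c \<le> frob_norm m m H * frob_norm m n (D X)"
      by (simp add: mult.commute)
    with H_pos have "c \<le> frob_norm m n (D X)"
      by simp
    then show False
      using norm_DX r \<open>c\<^sup>2 \<le> c\<close> c by linarith
  qed
  then have G_zero: "G X i k = 0" if "i < m" "k < m" for i k
    using that by (simp add: frob_norm_eq_0_iff H_def)
  show ?thesis
  proof (rule that[OF \<open>0 < \<epsilon>\<close>, of A])
    fix i k assume ik: "i < m" "k < m"
    have "gram_fun n A A i k = gram_fun n Q Q i k + G X i k"
      by (simp add: A_def G_def gram_fun_def sum.distrib algebra_simps)
    with ik show "gram_fun n A A i k = (if i = k then 1 else 0)"
      by (simp add: orth G_zero)
  next
    fix i j assume "i < m" "j < n" "Q i j = 0"
    then show "A i j = \<epsilon> * R i j"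
      by (simp add: A_def D_def E_def R'_def W_def restrict_supp_def)
  next
    fix i j assume "i < m" "j < n"
    then have "\<bar>D X i j\<bar> \<le> frob_norm m n (D X)"
      by (rule abs_entry_le_frob_norm)
    with norm_DX r show "\<bar>A i j - Q i j\<bar> < \<delta>"
      by (simp add: A_def)
  qed
qed

section \<open>Verification matrices\<close>

lemma column_stacking_less:
  fixes i j m n :: nat
  assumes "i < m" "j < n"
  shows "j * m + i < m * n"
proof -
  have "j * m + i < Suc j * m"
    using assms by simp
  also have "\<dots> \<le> n * m"
    using assms by (intro mult_le_mono1) simp
  finally show ?thesis
    by (simp add: mult.commute)
qed

text \<open>A nonzero kernel vector would be a linear dependence among the columns, which are
  distinct.\<close>

lemma cols_lin_indepD:
  assumes "cols_lin_indep A" "v \<in> carrier_vec (dim_col A)" "A *\<^sub>v v = 0\<^sub>v (dim_row A)"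
  shows "v = 0\<^sub>v (dim_col A)"
  using assms vec_space.lin_depI[of A "dim_row A" "dim_col A" v]
  by (auto simp: cols_lin_indep_def lin_indep_list_def)

lemma rows_lin_indepD:
  assumes "rows_lin_indep A" "v \<in> carrier_vec (dim_row A)"
    and "transpose_mat A *\<^sub>v v = 0\<^sub>v (dim_col A)"
  shows "v = 0\<^sub>v (dim_row A)"
  using assms cols_lin_indepD[of "transpose_mat A" v]
  by (simp add: cols_lin_indep_def rows_lin_indep_def)

lemma mem_vec_positions_iff:
  assumes "Q \<in> carrier_mat m n"
  shows "k \<in> vec_positions p Q \<longleftrightarrow> k < m * n \<and> p (Q $$ (k mod m, k div m))"
proof
  assume "k \<in> vec_positions p Q"
  then obtain i j where ij: "k = j * m + i" "i < m" "j < n" "p (Q $$ (i, j))"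
    using assms by (auto simp: vec_positions_def)
  then show "k < m * n \<and> p (Q $$ (k mod m, k div m))"
    using column_stacking_less[of i m j n] by simp
next
  assume k: "k < m * n \<and> p (Q $$ (k mod m, k div m))"
  then have "0 < m"
    by (cases m) auto
  with k have "k mod m < m" "k div m < n" "k = k div m * m + k mod m"
    by (simp_all add: less_mult_imp_div_less mult.commute)
  with k assms show "k \<in> vec_positions p Q"
    unfolding vec_positions_def by blast
qed

text \<open>\<open>pick I\<close> is strictly increasing into \<open>I\<close>, hence injective, and
  cardinalities agree. It turns sums over rows of a submatrix into sums over positions.\<close>

lemma bij_betw_pick:
  assumes "finite I"
  shows "bij_betw (pick I) {..<card I} I"
proof -
  have "inj_on (pick I) {..<card I}"
    by (rule linorder_inj_onI') (use pick_mono_le[of _ I] in \<open>fastforce\<close>)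
  moreover have "pick I ` {..<card I} \<subseteq> I"
    using pick_in_set_le[of _ I] by auto
  ultimately show ?thesis
    using assms by (simp add: bij_betw_def card_image card_subset_eq)
qed

text \<open>Division with remainder inverts \<open>j * m + i\<close>; thus column stacking preserves
  inner products.\<close>

lemma sum_column_stacking:
  fixes f :: "nat \<Rightarrow> nat \<Rightarrow> 'a::comm_monoid_add"
  shows "(\<Sum>k<m * n. f (k mod m) (k div m)) = (\<Sum>i<m. \<Sum>j<n. f i j)"
proof -
  have pos: "0 < m" if "k < m * n" for k
    using that by (cases m) auto
  show ?thesis
    unfolding sum.cartesian_product
    by (rule sum.reindex_bij_witness[of _ "\<lambda>(i, j). j * m + i" "\<lambda>k. (k mod m, k div m)"])
      (auto simp: column_stacking_less pos less_mult_imp_div_less mult.commute)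
qed

section \<open>Matrix units and the normal verification matrix\<close>

lemma unit_mat_mult_index:
  assumes "B \<in> carrier_mat l n" "b < l" "i < r" "j < n"
  shows "(unit_mat r l a b * B) $$ (i, j) = (if i = a then B $$ (b, j) else 0)"
proof -
  have "(unit_mat r l a b * B) $$ (i, j)
      = (\<Sum>k<l. (if i = a \<and> k = b then 1 else 0) * B $$ (k, j))"
    using assms by (simp add: unit_mat_def scalar_prod_def atLeast0LessThan)
  also have "\<dots> = (\<Sum>k<l. if k = b then (if i = a then B $$ (k, j) else 0) else 0)"
    by (intro sum.cong) auto
  finally show ?thesis
    using assms by simp
qed

lemma dim_unit_mat [simp]: "dim_row (unit_mat m n i j) = m" "dim_col (unit_mat m n i j) = n"
  by (simp_all add: unit_mat_def)

lemma unit_mat_carrier [simp]: "unit_mat m n i j \<in> carrier_mat m n"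
  by (simp add: unit_mat_def)

lemma vec_of_mat_index:
  assumes "A \<in> carrier_mat m n" "k < m * n"
  shows "vec_of_mat A $ k = A $$ (k mod m, k div m)"
  using assms by (auto simp: vec_of_mat_def)

text \<open>With \<open>q\<close> a column of \<open>Q\<close>, the bracket is the entry of
  \<open>C_ab\<close> in row \<open>i\<close> of that column, so the normal space matrix sends the
  upper triangle of \<open>X\<close> to \<open>X Q\<close>. Row \<open>i\<close> receives
  \<open>X i b * q b\<close> from the pairs \<open>(i, b)\<close> and, by symmetry,
  \<open>X i a * q a\<close> from the pairs \<open>(a, i)\<close>.\<close>

lemma sum_upper_triangle_symmetric:
  fixes X :: "nat \<Rightarrow> nat \<Rightarrow> real"
  assumes "i < m" and sym: "\<And>a b. a < m \<Longrightarrow> b < m \<Longrightarrow> X a b = X b a"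
  shows "(\<Sum>(a, b) \<in> Sigma {..<m} (\<lambda>a. {a..<m}).
      (if a = b then (if i = a then q a else 0)
       else (if i = a then q b else 0) + (if i = b then q a else 0)) * X a b) = (\<Sum>k<m. X i k * q k)"
proof -
  \<comment> \<open>The strict \<open>a < i\<close> in the second summand keeps the diagonal pair
    from counting twice.\<close>
  have "(\<Sum>(a, b) \<in> Sigma {..<m} (\<lambda>a. {a..<m}).
      (if a = b then (if i = a then q a else 0)
       else (if i = a then q b else 0) + (if i = b then q a else 0)) * X a b)
    = (\<Sum>a<m. \<Sum>b\<in>{a..<m}. (if a = i then X i b * q b else 0)
        + (if b = i then (if a < i then X i a * q a else 0) else 0))"
    using assms by (subst sum.Sigma) (auto intro!: sum.cong)
  also have "\<dots> = (\<Sum>a<m. if a = i then \<Sum>b\<in>{i..<m}. X i b * q b else 0)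
      + (\<Sum>a<m. if a < i then X i a * q a else 0)"
    unfolding sum.distrib
  proof (intro arg_cong2[where f = "(+)"] sum.cong refl)
    fix a assume "a \<in> {..<m}"
    show "(\<Sum>b\<in>{a..<m}. if a = i then X i b * q b else 0)
        = (if a = i then \<Sum>b\<in>{i..<m}. X i b * q b else 0)"
      by simp
    show "(\<Sum>b\<in>{a..<m}. if b = i then (if a < i then X i a * q a else 0) else 0)
        = (if a < i then X i a * q a else 0)"
      using \<open>i < m\<close> by simp
  qed
  also have "(\<Sum>a<m. if a = i then \<Sum>b\<in>{i..<m}. X i b * q b else 0) = (\<Sum>b\<in>{i..<m}. X i b * q b)"
    using \<open>i < m\<close> by simp
  also have "(\<Sum>a<m. if a < i then X i a * q a else 0) = (\<Sum>a\<in>{..<i}. X i a * q a)"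
    using \<open>i < m\<close> by (intro sum.mono_neutral_cong_right) auto
  also have "(\<Sum>b\<in>{i..<m}. X i b * q b) + (\<Sum>a\<in>{..<i}. X i a * q a) = (\<Sum>k<m. X i k * q k)"
    using \<open>i < m\<close> by (subst sum.union_disjoint[symmetric]) (auto intro!: sum.cong)
  finally show ?thesis .
qed

lemma sum_nth_distinct:
  assumes "distinct ps"
  shows "(\<Sum>k<length ps. f (ps ! k)) = sum f (set ps)"
  using assms sum.reindex_bij_betw[OF bij_betw_nth[OF assms refl refl]] by simp

text \<open>Applied to the upper triangle of a symmetric \<open>X\<close>, the verification matrix
  lists the entries of \<open>X Q\<close> on the support of \<open>Q\<close>. If these vanish,
  independence of the columns kills the upper triangle, and symmetry the rest.\<close>

lemma normal_verification_imp_sipp: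
  assumes Q: "Q \<in> carrier_mat m n" and indep: "cols_lin_indep (normal_verification_mat Q)"
  shows "strong_inner_product_property m n (\<lambda>i j. Q $$ (i, j))"
  unfolding strong_inner_product_property_def
proof (rule allI, intro impI)
  fix X :: "nat \<Rightarrow> nat \<Rightarrow> real"
  assume sym: "\<forall>i<m. \<forall>k<m. X i k = X k i"
    and XQ: "\<forall>i<m. \<forall>j<n. Q $$ (i, j) \<noteq> 0 \<longrightarrow> mult_fun m X (\<lambda>i j. Q $$ (i, j)) i j = 0"
  define I where "I = vec_positions (\<lambda>x. x \<noteq> 0) Q"
  \<comment> \<open>The index pairs in the column order of \<open>normal_space_mat\<close>.\<close>
  define ps where "ps = concat (map (\<lambda>i. map (Pair i) [i..<m]) [0..<m])"
  define C where "C = (\<lambda>(i, j). (if i = j then unit_mat m m i i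
    else unit_mat m m i j + unit_mat m m j i) * Q)"
  have ps: "set ps = Sigma {..<m} (\<lambda>a. {a..<m})"
    by (auto simp: ps_def image_iff)
  have "distinct ps"
    unfolding ps_def
    \<comment> \<open>Blocks for different rows are told apart by their heads \<open>(i, i)\<close>,
      each block being nonempty as \<open>i < m\<close>.\<close>
    by (rule distinct_concat) (auto simp: distinct_map inj_on_def hd_map dest!: arg_cong[where f = hd])
  have NS: "normal_space_mat Q = mat_of_cols (m * n) (map (\<lambda>p. vec_of_mat (C p)) ps)"
    using Q by (simp add: normal_space_mat_def ps_def C_def map_concat o_def Let_def)
  define v where "v = vec (length ps) (\<lambda>k. X (fst (ps ! k)) (snd (ps ! k)))"
  \<comment> \<open>\<open>submatrix\<close> counts only selected indices within range; all
    positions in \<open>I\<close> are.\<close>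
  have I_dim: "{k. k < m * n \<and> k \<in> I} = I"
    using mem_vec_positions_iff[OF Q] by (auto simp: I_def)
  have dims: "dim_row (normal_verification_mat Q) = card I"
    "dim_col (normal_verification_mat Q) = length ps"
    using I_dim by (simp_all add: normal_verification_mat_def dim_submatrix NS I_def)
  have "normal_verification_mat Q *\<^sub>v v = 0\<^sub>v (card I)"
  proof (rule eq_vecI)
    fix a assume "a < dim_vec (0\<^sub>v (card I) :: real vec)"
    then have a: "a < card I"
      by simp
    define p where "p = pick I a"
    have p: "p \<in> I"
      using a pick_in_set_le by (simp add: p_def)
    then have "p < m * n" "Q $$ (p mod m, p div m) \<noteq> 0"
      by (simp_all add: I_def mem_vec_positions_iff[OF Q])
    then have "0 < m"
      by (cases m) auto
    then have p_bounds: "p mod m < m" "p div m < n"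
      using \<open>p < m * n\<close> by (simp_all add: less_mult_imp_div_less mult.commute)
    have entry: "normal_verification_mat Q $$ (a, k) = C (ps ! k) $$ (p mod m, p div m)"
      if "k < length ps" for k
    proof -
      have "C (ps ! k) \<in> carrier_mat m n"
        using Q by (auto simp: C_def split: prod.splits intro!: mult_carrier_mat[of _ m m])
      moreover have "normal_verification_mat Q $$ (a, k) = normal_space_mat Q $$ (p, k)"
        using a that I_dim unfolding normal_verification_mat_def p_def I_def[symmetric]
        by (subst submatrix_index) (simp_all add: NS pick_UNIV)
      ultimately show ?thesis
        using that \<open>p < m * n\<close> by (simp add: NS mat_of_cols_index vec_of_mat_index)
    qed
    have C_entry: "C (a, b) $$ (p mod m, p div m) =
        (if a = b then (if p mod m = a then Q $$ (a, p div m) else 0)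
         else (if p mod m = a then Q $$ (b, p div m) else 0)
           + (if p mod m = b then Q $$ (a, p div m) else 0))"
      if ab: "a \<in> {..<m}" "b \<in> {a..<m}" for a b
    proof -
      have "(unit_mat m m a b + unit_mat m m b a) * Q = unit_mat m m a b * Q + unit_mat m m b a * Q"
        by (rule add_mult_distrib_mat[OF unit_mat_carrier unit_mat_carrier Q])
      then have "C (a, b) $$ (p mod m, p div m) =
          (if a = b then (unit_mat m m a a * Q) $$ (p mod m, p div m)
           else (unit_mat m m a b * Q) $$ (p mod m, p div m)
             + (unit_mat m m b a * Q) $$ (p mod m, p div m))"
        using p_bounds Q by (simp add: C_def del: index_mult_mat(1))
      then show ?thesis
        using ab p_bounds by (simp add: unit_mat_mult_index[OF Q] del: index_mult_mat(1))
    qed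
    have "(normal_verification_mat Q *\<^sub>v v) $ a
        = (\<Sum>k<length ps. normal_verification_mat Q $$ (a, k) * v $ k)"
      using a dims by (simp add: scalar_prod_def v_def atLeast0LessThan)
    also have "\<dots> = (\<Sum>k<length ps. (\<lambda>(i, j). C (i, j) $$ (p mod m, p div m) * X i j) (ps ! k))"
      by (intro sum.cong) (auto simp: entry v_def case_prod_unfold)
    also have "\<dots> = (\<Sum>(i, j)\<in>Sigma {..<m} (\<lambda>a. {a..<m}). C (i, j) $$ (p mod m, p div m) * X i j)"
      unfolding sum_nth_distinct[OF \<open>distinct ps\<close>] ps ..
    also have "\<dots> = (\<Sum>(a, b)\<in>Sigma {..<m} (\<lambda>a. {a..<m}).
        (if a = b then (if p mod m = a then Q $$ (a, p div m) else 0)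
         else (if p mod m = a then Q $$ (b, p div m) else 0)
           + (if p mod m = b then Q $$ (a, p div m) else 0)) * X a b)"
      by (intro sum.cong refl) (simp only: split_paired_all mem_Sigma_iff prod.case C_entry)
    also have "\<dots> = mult_fun m X (\<lambda>i j. Q $$ (i, j)) (p mod m) (p div m)"
      unfolding mult_fun_def using sym p_bounds by (intro sum_upper_triangle_symmetric) auto
    also have "\<dots> = 0"
      using XQ p_bounds \<open>Q $$ (p mod m, p div m) \<noteq> 0\<close> by simp
    finally show "(normal_verification_mat Q *\<^sub>v v) $ a = 0\<^sub>v (card I) $ a"
      using a by simp
  qed (simp add: dims)
  then have "v = 0\<^sub>v (length ps)"
    using cols_lin_indepD[OF indep, of v] by (simp add: dims v_def)
  then have v_zero: "X (fst (ps ! k)) (snd (ps ! k)) = 0" if "k < length ps" for k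
  proof -
    have "v $ k = 0"
      using \<open>v = 0\<^sub>v (length ps)\<close> that by simp
    then show ?thesis
      using that by (simp add: v_def)
  qed
  have upper: "X a b = 0" if "a \<le> b" "b < m" for a b
  proof -
    have "(a, b) \<in> set ps"
      using that by (simp add: ps)
    then show ?thesis
      using v_zero by (metis fst_conv in_set_conv_nth snd_conv)
  qed
  show "\<forall>i<m. \<forall>k<m. X i k = 0"
    using upper sym by (metis nat_le_linear)
qed

section \<open>Tangent verification matrix\<close>

text \<open>\<open>Z = X Q\<close> is orthogonal to every tangent vector and vanishes on the support
  of \<open>Q\<close>. Its entries at the zeros of \<open>Q\<close> thus form a linear relation
  among the rows of the verification matrix, so \<open>Z = 0\<close>, and then
  \<open>X = 0\<close>.\<close>

lemma tangent_verification_imp_sipp: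
  assumes Q: "Q \<in> carrier_mat m n" and P: "P \<in> carrier_mat n n" and "m \<le> n"
    and orth: "\<And>i k. i < m \<Longrightarrow> k < m \<Longrightarrow>
      gram_fun n (\<lambda>i j. Q $$ (i, j)) (\<lambda>i j. Q $$ (i, j)) i k = (if i = k then 1 else 0)"
    and QP: "\<And>k b. k < m \<Longrightarrow> b < n \<Longrightarrow>
      gram_fun n (\<lambda>i j. Q $$ (i, j)) (\<lambda>i j. P $$ (i, j)) k b = (if k = b then 1 else 0)"
    and indep: "rows_lin_indep (tangent_verification_mat P Q)"
  shows "strong_inner_product_property m n (\<lambda>i j. Q $$ (i, j))"
  unfolding strong_inner_product_property_def
proof (rule allI, intro impI)
  fix X :: "nat \<Rightarrow> nat \<Rightarrow> real"
  assume sym: "\<forall>i<m. \<forall>k<m. X i k = X k i"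
    and XQ: "\<forall>i<m. \<forall>j<n. Q $$ (i, j) \<noteq> 0 \<longrightarrow> mult_fun m X (\<lambda>i j. Q $$ (i, j)) i j = 0"
  define Z where "Z = mult_fun m X (\<lambda>i j. Q $$ (i, j))"
  define I where "I = vec_positions (\<lambda>x. x = 0) Q"
  define cs where "cs =
    [vec_of_mat ((unit_mat m n i j - unit_mat m n j i) * P). i \<leftarrow> [0..<m], j \<leftarrow> [Suc i..<m]] @
    [vec_of_mat (unit_mat m n i j * P). i \<leftarrow> [0..<m], j \<leftarrow> [m..<n]]"
  have TS: "tangent_space_mat P Q = mat_of_cols (m * n) cs"
    using Q by (simp add: tangent_space_mat_def cs_def Let_def)
  \<comment> \<open>\<open>Z P\<^sup>T = X Q P\<^sup>T\<close> is \<open>X\<close> followed by zero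
    columns.\<close>
  have ZP: "(\<Sum>j<n. Z a j * P $$ (b, j)) = (if b < m then X a b else 0)" if "b < n" for a b
  proof -
    have "(\<Sum>j<n. Z a j * P $$ (b, j)) = gram_fun n Z (\<lambda>i j. P $$ (i, j)) a b"
      by (simp add: gram_fun_def)
    also have "\<dots> = (\<Sum>h<m. if h = b then X a h else 0)"
      unfolding Z_def gram_fun_mult_fun using that by (intro sum.cong) (auto simp: QP)
    finally show ?thesis
      by simp
  qed
  \<comment> \<open>Pairing with \<open>E_ab P\<close> reads off entry \<open>(a, b)\<close> of
    \<open>Z P\<^sup>T\<close>.\<close>
  have unit_inner: "frob_inner m n (\<lambda>i j. (unit_mat m n a b * P) $$ (i, j)) Z
      = (if b < m then X a b else 0)" if "a < m" "b < n" for a b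
  proof -
    have "frob_inner m n (\<lambda>i j. (unit_mat m n a b * P) $$ (i, j)) Z
        = (\<Sum>i<m. if i = a then \<Sum>j<n. Z a j * P $$ (b, j) else 0)"
      unfolding frob_inner_def
      by (intro sum.cong refl)
        (auto simp: unit_mat_mult_index[OF P \<open>b < n\<close>] mult.commute simp del: index_mult_mat(1))
    with that show ?thesis
      by (simp add: ZP)
  qed
  \<comment> \<open>For \<open>K_ab P\<close> the pairing is \<open>X a b - X b a = 0\<close>; for
    \<open>E_ab P\<close> with \<open>m \<le> b\<close> it meets a zero column.\<close>
  have column: "\<exists>B \<in> carrier_mat m n. c = vec_of_mat B \<and> frob_inner m n (\<lambda>i j. B $$ (i, j)) Z = 0"
    if c: "c \<in> set cs" for c
  proof -
    consider a b where "a < b" "b < m" "c = vec_of_mat ((unit_mat m n a b - unit_mat m n b a) * P)"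
      | a b where "a < m" "m \<le> b" "b < n" "c = vec_of_mat (unit_mat m n a b * P)"
      using c by (auto simp: cs_def Suc_le_eq)
    then show ?thesis
    proof cases
      case 1
      have "(unit_mat m n a b - unit_mat m n b a) * P = unit_mat m n a b * P - unit_mat m n b a * P"
        by (rule minus_mult_distrib_mat[OF unit_mat_carrier unit_mat_carrier P])
      then have "frob_inner m n (\<lambda>i j. (unit_mat m n a b * P) $$ (i, j)) Z
          = frob_inner m n (\<lambda>i j. ((unit_mat m n a b - unit_mat m n b a) * P) $$ (i, j)) Z
            + frob_inner m n (\<lambda>i j. (unit_mat m n b a * P) $$ (i, j)) Z"
        unfolding frob_inner_add_left[symmetric] using P
        by (intro frob_inner_cong) (simp del: index_mult_mat(1))
      then have "frob_inner m n (\<lambda>i j. ((unit_mat m n a b - unit_mat m n b a) * P) $$ (i, j)) Z = 0"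
        using 1 sym \<open>m \<le> n\<close> by (simp add: unit_inner)
      moreover have "(unit_mat m n a b - unit_mat m n b a) * P \<in> carrier_mat m n"
        using P by (auto intro!: mult_carrier_mat[of _ m n] minus_carrier_mat)
      ultimately show ?thesis
        using 1 by blast
    next
      case 2
      have "unit_mat m n a b * P \<in> carrier_mat m n"
        by (rule mult_carrier_mat[OF unit_mat_carrier P])
      with 2 unit_inner[of a b] show ?thesis
        by auto
    qed
  qed
  have I_dim: "{k. k < m * n \<and> k \<in> I} = I"
    using mem_vec_positions_iff[OF Q] by (auto simp: I_def)
  then have "finite I"
    by (metis finite_Collect_conjI finite_Collect_less_nat)
  have I_sub: "I \<subseteq> {..<m * n}"
    using I_dim by auto
  have mod_div: "k mod m < m" "k div m < n" if "k < m * n" for k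
    using that by (cases m; simp add: less_mult_imp_div_less mult.commute)+
  have Z_off: "Z (k mod m) (k div m) = 0" if "k < m * n" "k \<notin> I" for k
    using that mod_div[of k] XQ by (simp add: I_def mem_vec_positions_iff[OF Q] Z_def)
  \<comment> \<open>The entries of \<open>Z\<close> at the zeros of \<open>Q\<close>, in the row
    order of the submatrix.\<close>
  define z where "z = vec (card I) (\<lambda>k. Z (pick I k mod m) (pick I k div m))"
  have dims: "dim_row (tangent_verification_mat P Q) = card I"
    "dim_col (tangent_verification_mat P Q) = length cs"
    using I_dim by (simp_all add: tangent_verification_mat_def dim_submatrix TS I_def)
  have "transpose_mat (tangent_verification_mat P Q) *\<^sub>v z = 0\<^sub>v (length cs)"
  proof (rule eq_vecI)
    fix l assume "l < dim_vec (0\<^sub>v (length cs) :: real vec)"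
    then have l: "l < length cs"
      by simp
    then obtain B where B: "B \<in> carrier_mat m n" "cs ! l = vec_of_mat B"
      "frob_inner m n (\<lambda>i j. B $$ (i, j)) Z = 0"
      using column nth_mem by blast
    have entry: "tangent_verification_mat P Q $$ (k, l) = B $$ (pick I k mod m, pick I k div m)"
      if "k < card I" for k
    proof -
      have "pick I k < m * n"
        using pick_in_set_le[OF that] I_sub by auto
      moreover have "tangent_verification_mat P Q $$ (k, l) = tangent_space_mat P Q $$ (pick I k, l)"
        using l that I_dim unfolding tangent_verification_mat_def I_def[symmetric]
        by (subst submatrix_index) (simp_all add: TS pick_UNIV)
      ultimately show ?thesis
        using l B by (simp add: TS mat_of_cols_index vec_of_mat_index)
    qed
    have "(transpose_mat (tangent_verification_mat P Q) *\<^sub>v z) $ l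
        = (\<Sum>k<card I. tangent_verification_mat P Q $$ (k, l) * z $ k)"
      using l dims by (simp add: scalar_prod_def z_def atLeast0LessThan)
    also have "\<dots> = (\<Sum>k<card I. (\<lambda>p. B $$ (p mod m, p div m) * Z (p mod m) (p div m)) (pick I k))"
      by (intro sum.cong) (auto simp: entry z_def)
    also have "\<dots> = (\<Sum>p\<in>I. B $$ (p mod m, p div m) * Z (p mod m) (p div m))"
      by (rule sum.reindex_bij_betw[OF bij_betw_pick[OF \<open>finite I\<close>]])
    \<comment> \<open>Positions outside \<open>I\<close> add nothing, so the relation to check is
      orthogonality over the whole matrix.\<close>
    also have "\<dots> = (\<Sum>p<m * n. B $$ (p mod m, p div m) * Z (p mod m) (p div m))"
      using I_sub Z_off by (intro sum.mono_neutral_left) auto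
    also have "\<dots> = frob_inner m n (\<lambda>i j. B $$ (i, j)) Z"
      unfolding frob_inner_def by (rule sum_column_stacking)
    finally show "(transpose_mat (tangent_verification_mat P Q) *\<^sub>v z) $ l = 0\<^sub>v (length cs) $ l"
      using l B by simp
  qed (simp add: dims)
  then have "z = 0\<^sub>v (card I)"
    using rows_lin_indepD[OF indep, of z] by (simp add: dims z_def)
  then have z_zero: "Z (pick I k mod m) (pick I k div m) = 0" if "k < card I" for k
  proof -
    have "z $ k = 0"
      using \<open>z = 0\<^sub>v (card I)\<close> that by simp
    then show ?thesis
      using that by (simp add: z_def)
  qed
  have Z_zero: "Z (k mod m) (k div m) = 0" if "k < m * n" for k
  proof (cases "k \<in> I")
    case True
    then obtain l where "l < card I" "k = pick I l"
      using bij_betw_pick[OF \<open>finite I\<close>] by (metis bij_betw_iff_bijections lessThan_iff)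
    then show ?thesis
      using z_zero by simp
  qed (use that Z_off in simp)
  have "frob_inner m n Z Z = (\<Sum>k<m * n. Z (k mod m) (k div m) * Z (k mod m) (k div m))"
    unfolding frob_inner_def by (rule sum_column_stacking[symmetric])
  then have "frob_norm m n Z = 0"
    by (simp add: frob_norm_def Z_zero)
  \<comment> \<open>\<open>X \<mapsto> X Q\<close> is an isometry.\<close>
  then have "frob_norm m m X = 0"
    using frob_norm_mult_fun_orthogonal[of m n "\<lambda>i j. Q $$ (i, j)" m X, OF orth] by (simp add: Z_def)
  then show "\<forall>i<m. \<forall>k<m. X i k = 0"
    by (simp add: frob_norm_eq_0_iff)
qed

section \<open>Super patterns\<close>

text \<open>A displacement smaller than every nonzero absolute entry keeps the signs on the support
  of \<open>Q\<close>; at its zeros, \<epsilon> times an entry of \<open>R\<close> with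
  \<open>\<epsilon> > 0\<close> has the sign that \<open>R\<close> prescribes.\<close>

lemma sipp_imp_super_pattern_allows_orthogonality:
  assumes Q: "Q \<in> orth_mats m n"
    and sipp: "strong_inner_product_property m n (\<lambda>i j. Q $$ (i, j))"
    and super: "super_pattern T (sgn_mat Q)"
  shows "allows_orthogonality T"
proof -
  have dimQ: "Q \<in> carrier_mat m n" and QQ: "Q * transpose_mat Q = 1\<^sub>m m"
    using Q by (auto simp: orth_mats_def)
  have gram: "gram_fun n (\<lambda>i j. A $$ (i, j)) (\<lambda>i j. A $$ (i, j)) i k = (A * transpose_mat A) $$ (i, k)"
    if "A \<in> carrier_mat m n" "i < m" "k < m" for A :: "real mat" and i k
    using that by (simp add: gram_fun_def scalar_prod_def atLeast0LessThan)
  obtain R where R: "R \<in> carrier_mat m n" "sign_pattern R" "T = fill_zeros (sgn_mat Q) R"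
    using super dimQ by (auto simp: super_pattern_def sgn_mat_def)
  \<comment> \<open>Inserting 1 keeps \<open>L\<close> nonempty even if \<open>Q\<close> has no
    entries.\<close>
  define L where "L = insert 1 ((\<lambda>(i, j). \<bar>Q $$ (i, j)\<bar>) ` ({..<m} \<times> {..<n}) - {0})"
  have "finite L" "L \<noteq> {}" "\<forall>x\<in>L. 0 < x"
    by (auto simp: L_def)
  then have delta: "0 < Min L"
    by simp
  have orthQ: "gram_fun n (\<lambda>i j. Q $$ (i, j)) (\<lambda>i j. Q $$ (i, j)) i k = (if i = k then 1 else 0)"
    if "i < m" "k < m" for i k
    using that by (simp add: gram[OF dimQ] QQ)
  show ?thesis
  proof (rule strong_inner_product_property_extension[OF orthQ sipp delta, of "\<lambda>i j. R $$ (i, j)"])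
    fix A \<epsilon> assume A: "0 < \<epsilon>"
      "\<And>i k. i < m \<Longrightarrow> k < m \<Longrightarrow> gram_fun n A A i k = (if i = k then 1 else 0)"
      "\<And>i j. i < m \<Longrightarrow> j < n \<Longrightarrow> Q $$ (i, j) = 0 \<Longrightarrow> A i j = \<epsilon> * R $$ (i, j)"
      "\<And>i j. i < m \<Longrightarrow> j < n \<Longrightarrow> Q $$ (i, j) \<noteq> 0 \<Longrightarrow> \<bar>A i j - Q $$ (i, j)\<bar> < Min L"
    define A' where "A' = mat m n (\<lambda>(i, j). A i j)"
    have "A' * transpose_mat A' = 1\<^sub>m m"
    proof (rule eq_matI)
      fix i k assume "i < dim_row (1\<^sub>m m :: real mat)" "k < dim_col (1\<^sub>m m :: real mat)"
      then have ik: "i < m" "k < m"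
        by auto
      have "gram_fun n (\<lambda>i j. A' $$ (i, j)) (\<lambda>i j. A' $$ (i, j)) i k = gram_fun n A A i k"
        using ik by (simp add: gram_fun_def A'_def)
      then show "(A' * transpose_mat A') $$ (i, k) = 1\<^sub>m m $$ (i, k)"
        using ik gram[of A' i k] A(2) by (simp add: A'_def)
    qed (simp_all add: A'_def)
    then have "A' \<in> orth_mats m n"
      by (simp add: orth_mats_def A'_def)
    moreover have "sgn (A i j) = T $$ (i, j)" if ij: "i < m" "j < n" for i j
    proof (cases "Q $$ (i, j) = 0")
      case True
      have "R $$ (i, j) \<in> elements_mat R"
        using ij R by auto
      then have "R $$ (i, j) \<in> {0, 1, -1}"
        using R(2) by (auto simp: sign_pattern_def)
      \<comment> \<open>Entries of a sign pattern are their own signs.\<close>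
      then have "sgn (A i j) = R $$ (i, j)"
        using A(1) A(3)[OF ij True] by (auto simp: sgn_mult)
      then show ?thesis
        using True ij dimQ by (simp add: R(3) fill_zeros_def sgn_mat_def)
    next
      case False
      then have "\<bar>Q $$ (i, j)\<bar> \<in> L"
        using ij by (force simp: L_def)
      then have "Min L \<le> \<bar>Q $$ (i, j)\<bar>"
        using \<open>finite L\<close> by simp
      with A(4)[OF ij False] have "\<bar>A i j - Q $$ (i, j)\<bar> < \<bar>Q $$ (i, j)\<bar>"
        by linarith
      then have "sgn (A i j) = sgn (Q $$ (i, j))"
        by (auto simp: sgn_if)
      then show ?thesis
        using False ij dimQ by (simp add: R(3) fill_zeros_def sgn_mat_def sgn_zero_iff)
    qed
    moreover have "dim_row T = m" "dim_col T = n"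
      using dimQ by (simp_all add: R(3) fill_zeros_def sgn_mat_def)
    ultimately show ?thesis
      unfolding allows_orthogonality_def
      by (intro bexI[of _ A']) (auto simp: sgn_mat_def A'_def)
  qed
qed

theorem theorem6p6:
  fixes m n :: nat and Q P S :: "real mat"
  assumes "m \<le> n"
    and "Q \<in> orth_mats m n"
    and "sgn_mat Q = S"
    and "P \<in> orth_mats n n"
    and "Q * transpose_mat P =
      four_block_mat (1\<^sub>m m) (0\<^sub>m m (n - m)) (0\<^sub>m 0 m) (0\<^sub>m 0 (n - m))"
  shows "(rows_lin_indep (tangent_verification_mat P Q) \<longrightarrow>
            (\<forall>T. super_pattern T S \<longrightarrow> allows_orthogonality T)) \<and>
         (cols_lin_indep (normal_verification_mat Q) \<longrightarrow>
            (\<forall>T. super_pattern T S \<longrightarrow> allows_orthogonality T))"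
proof -
  have Q: "Q \<in> carrier_mat m n" "Q * transpose_mat Q = 1\<^sub>m m" and P: "P \<in> carrier_mat n n"
    using assms(2,4) by (auto simp: orth_mats_def)
  have gram: "gram_fun n (\<lambda>i j. Q $$ (i, j)) (\<lambda>i j. B $$ (i, j)) i k = (Q * transpose_mat B) $$ (i, k)"
    if "B \<in> carrier_mat l n" "i < m" "k < l" for B l i k
    using that Q by (simp add: gram_fun_def scalar_prod_def atLeast0LessThan)
  have "strong_inner_product_property m n (\<lambda>i j. Q $$ (i, j))"
    if "rows_lin_indep (tangent_verification_mat P Q)"
  proof (rule tangent_verification_imp_sipp[OF Q(1) P assms(1) _ _ that])
    show "gram_fun n (\<lambda>i j. Q $$ (i, j)) (\<lambda>i j. Q $$ (i, j)) i k = (if i = k then 1 else 0)"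
      if "i < m" "k < m" for i k
      using that Q by (simp add: gram)
    show "gram_fun n (\<lambda>i j. Q $$ (i, j)) (\<lambda>i j. P $$ (i, j)) k b = (if k = b then 1 else 0)"
      if "k < m" "b < n" for k b
      using that P assms(1,5) by (simp add: gram)
  qed
  moreover have "strong_inner_product_property m n (\<lambda>i j. Q $$ (i, j))"
    if "cols_lin_indep (normal_verification_mat Q)"
    using Q(1) that by (rule normal_verification_imp_sipp)
  ultimately show ?thesis
    using sipp_imp_super_pattern_allows_orthogonality[OF assms(2)] assms(3) by blast
qed

end
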